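(* Let $\mathcal{C}$ be a set of Boolean constraints of arity $k$ such that $SAT(\mathcal{C})$ has a sharp threshold. Suppose there exists $\epsilon>0$ such that every minimally unsatisfiable formula $F$ (built from constraints of $\mathcal{C}$) satisfies \[ c^{*}(F)>\frac{1+\epsilon}{k-1}. \] Then for every distribution $\mathcal{P}$ with $\mathrm{supp}(\mathcal{P})=\mathcal{C}$, $SAT(\mathcal{P})$ has a first-order phase transition.
   Context: A Boolean constraint of arity $k$ is a nonempty subset of $\{0,1\}^k$ of allowed assignments. A formula over $\mathcal{C}$ is a conjunction of constraints from $\mathcal{C}$ each applied to an ordered $k$-tuple of distinct variables. Random model $SAT_{n,M}(\mathcal{P})$: on $n$ variables, choose $M$ $k$-subsets of variables uniformly at random with repetition; for each, take a uniformly random ordering of its variables and apply a constraint drawn according to $\mathcal{P}$. $SAT(\mathcal{C})$ denotes this model with $\mathcal{P}$ uniform on $\mathcal{C}$. Sharp threshold: there is $c(n)$ bounded away from $0$ such that for every $\epsilon>0$ the random formula is satisfiable with probability $\to1$ when $M<(c(n)-\epsilon)n$ and with probability $\to 0$ when $M>(c(n)+\epsilon)n$. A formula is minimally unsatisfiable if it is unsatisfiable but every proper subformula is satisfiable. For a formula $F$, $c^{*}(F)=\max\{|Constraints(G)|/|Var(G)| : \emptyset\neq G\subseteq F\}$. Spine: $Spine(\Phi)$ is the set of variables $x$ such that there exist a satisfiable subformula $\Xi\subseteq\Phi$ and a constraint from $\mathcal{C}$ applied to a tuple of variables containing $x$, call it $C$, with $\Xi\wedge C$ unsatisfiable. $SAT(\mathcal{P})$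 (having a sharp threshold) has a first-order phase transition if there exists $\eta>0$ such that for every sequence $M=M(n)$, with $\Phi$ drawn from $SAT_{n,M(n)}(\mathcal{P})$: $\lim_n\Pr[\Phi\text{ satisfiable}]=0$ implies $\lim_n\Pr[|Spine(\Phi)|/n\geq\eta]=1$. *)

theory Defs
  imports "HOL-Probability.Probability" "HOL-Combinatorics.Multiset_Permutations"
begin

(* A constraint is the set of its allowed assignments, each a bool list of length k;
   the i-th entry is the value of the i-th variable. *)
definition is_constraint :: "nat \<Rightarrow> bool list set \<Rightarrow> bool" where
  "is_constraint k R \<longleftrightarrow> R \<noteq> {} \<and> R \<subseteq> {a. length a = k}"

definition var_tuples :: "nat \<Rightarrow> nat set \<Rightarrow> nat list set" where
  "var_tuples k V = {xs. length xs = k \<and> distinct xs \<and> set xs \<subseteq> V}"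

(* A constraint together with the tuple of variables it is applied to. *)
type_synonym clause = "bool list set \<times> nat list"

(* A conjunction is represented by the set of its conjuncts: satisfiability and the spine
   do not depend on repetitions, and a minimally unsatisfiable formula has none. *)
definition is_formula :: "nat \<Rightarrow> bool list set set \<Rightarrow> nat set \<Rightarrow> clause set \<Rightarrow> bool" where
  "is_formula k C V F \<longleftrightarrow> finite F \<and> F \<subseteq> C \<times> var_tuples k V"

definition satisfiable :: "clause set \<Rightarrow> bool" where
  "satisfiable F \<longleftrightarrow> (\<exists>\<sigma> :: nat \<Rightarrow> bool. \<forall>(R, xs)\<in>F. map \<sigma> xs \<in> R)"

definition minimally_unsatisfiable :: "clause set \<Rightarrow> bool" where
  "minimally_unsatisfiable F \<longleftrightarrow> \<not> satisfiable F \<and> (\<forall>G. G \<subset> F \<longrightarrow> satisfiable G)"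

definition vars :: "clause set \<Rightarrow> nat set" where
  "vars F = (\<Union>(R, xs)\<in>F. set xs)"

definition cstar :: "clause set \<Rightarrow> real" where
  "cstar F = Max {real (card G) / real (card (vars G)) | G. G \<noteq> {} \<and> G \<subseteq> F}"

(* The constraint added to the subformula may use any variables in V,
   not only those occurring in the formula. *)
definition spine :: "nat \<Rightarrow> bool list set set \<Rightarrow> nat set \<Rightarrow> clause set \<Rightarrow> nat set" where
  "spine k C V F =
     {x. \<exists>\<Xi> R xs. \<Xi> \<subseteq> F \<and> satisfiable \<Xi> \<and> R \<in> C \<and> xs \<in> var_tuples k V \<and> x \<in> set xs \<and>
        \<not> satisfiable (insert (R, xs) \<Xi>)}"

(* The k-subsets of {..<n} form an empty set if n < k, where pmf_of_set is unspecified;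
   only the behaviour for large n is ever used. *)
definition random_clause :: "nat \<Rightarrow> bool list set pmf \<Rightarrow> nat \<Rightarrow> clause pmf" where
  "random_clause k P n =
     do {
       S \<leftarrow> pmf_of_set {S. S \<subseteq> {..<n} \<and> card S = k};
       xs \<leftarrow> pmf_of_set (permutations_of_set S);
       R \<leftarrow> P;
       return_pmf (R, xs)
     }"

definition random_formula :: "nat \<Rightarrow> bool list set pmf \<Rightarrow> nat \<Rightarrow> nat \<Rightarrow> clause set pmf" where
  "random_formula k P n M = map_pmf set (replicate_pmf M (random_clause k P n))"

definition prob_sat :: "nat \<Rightarrow> bool list set pmf \<Rightarrow> nat \<Rightarrow> nat \<Rightarrow> real" where
  "prob_sat k P n M = measure_pmf.prob (random_formula k P n M) {\<Phi>. satisfiable \<Phi>}"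

definition sharp_threshold :: "nat \<Rightarrow> bool list set pmf \<Rightarrow> bool" where
  "sharp_threshold k P \<longleftrightarrow>
     (\<exists>c :: nat \<Rightarrow> real. (\<exists>\<delta>>0. \<forall>n. \<delta> \<le> c n) \<and>
       (\<forall>\<epsilon>>0. \<forall>M :: nat \<Rightarrow> nat.
          ((\<forall>\<^sub>F n in sequentially. real (M n) < (c n - \<epsilon>) * real n) \<longrightarrow>
             (\<lambda>n. prob_sat k P n (M n)) \<longlonglongrightarrow> 1) \<and>
          ((\<forall>\<^sub>F n in sequentially. (c n + \<epsilon>) * real n < real (M n)) \<longrightarrow>
             (\<lambda>n. prob_sat k P n (M n)) \<longlonglongrightarrow> 0)))"

definition first_order_phase_transition :: "nat \<Rightarrow> bool list set pmf \<Rightarrow> bool" where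
  "first_order_phase_transition k P \<longleftrightarrow>
     (\<exists>\<eta>>0. \<forall>M :: nat \<Rightarrow> nat.
        (\<lambda>n. prob_sat k P n (M n)) \<longlonglongrightarrow> 0 \<longrightarrow>
        (\<lambda>n. measure_pmf.prob (random_formula k P n (M n))
               {\<Phi>. \<eta> \<le> real (card (spine k (set_pmf P) {..<n} \<Phi>)) / real n}) \<longlonglongrightarrow> 1)"

end

theory Submission
  imports Defs
begin

text \<open>
  Deleting a constraint from a minimally unsatisfiable formula leaves a satisfiable formula that the
  constraint makes unsatisfiable, so every variable of a minimally unsatisfiable subformula lies in
  the spine. By hypothesis such a subformula contains a set of constraints on \<open>v\<close> variables with more
  than \<open>\<alpha> v\<close> constraints, where \<open>\<alpha> = (1 + \<epsilon>) / (k - 1)\<close>. In a random formula with at most \<open>K n\<close>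
  constraints the expected number of such dense spots on \<open>v \<le> \<delta> n\<close> variables is at most
  \<open>(A (v / n)\<^sup>\<epsilon>)\<^sup>v\<close>, and these bounds sum to \<open>O(n\<^sup>-\<^sup>\<epsilon>)\<close>; hence an unsatisfiable random formula
  has a spine of size at least \<open>\<delta> n\<close> with high probability. Larger \<open>M\<close> reduce to \<open>K n\<close>, because the
  spine grows with the formula and \<open>K n\<close> constraints are already unsatisfiable with high probability.
\<close>

section \<open>Minimally unsatisfiable subformulas, the spine and \<open>cstar\<close>\<close>

lemma unsatisfiable_contains_minimal:
  assumes "finite F" "\<not> satisfiable F"
  obtains G where "G \<subseteq> F" "minimally_unsatisfiable G"
  using assms
proof (induction F arbitrary: thesis rule: finite_psubset_induct)
  case (psubset F)
  show ?case
  proof (cases "minimally_unsatisfiable F")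
    case False
    then obtain G where G: "G \<subset> F" "\<not> satisfiable G"
      using psubset.prems unfolding minimally_unsatisfiable_def by blast
    obtain H where "H \<subseteq> G" "minimally_unsatisfiable H"
      using psubset.IH[OF G(1) _ G(2)] by blast
    then show ?thesis using psubset.prems G by blast
  qed (use psubset.prems in blast)
qed

lemma vars_minimally_unsatisfiable_subset_spine:
  assumes "minimally_unsatisfiable F" "F \<subseteq> \<Phi>" "\<Phi> \<subseteq> C \<times> var_tuples k V"
  shows "vars F \<subseteq> spine k C V \<Phi>"
proof
  fix x assume "x \<in> vars F"
  then obtain R xs where c: "(R, xs) \<in> F" "x \<in> set xs"
    unfolding vars_def by blast
  have "F - {(R, xs)} \<subset> F" using c(1) by blast
  then have "satisfiable (F - {(R, xs)})"
    using assms(1) unfolding minimally_unsatisfiable_def by simp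
  moreover have "\<not> satisfiable (insert (R, xs) (F - {(R, xs)}))"
    using assms(1) c unfolding minimally_unsatisfiable_def by (simp add: insert_absorb)
  moreover have "F - {(R, xs)} \<subseteq> \<Phi>" "R \<in> C" "xs \<in> var_tuples k V"
    using assms(2,3) c by blast+
  ultimately show "x \<in> spine k C V \<Phi>"
    unfolding spine_def using c(2) by (intro CollectI exI[of _ "F - {(R, xs)}"] exI conjI)
qed

lemma spine_subset: "spine k C V \<Phi> \<subseteq> V"
  unfolding spine_def var_tuples_def by blast

lemma spine_mono: "\<Phi> \<subseteq> \<Psi> \<Longrightarrow> spine k C V \<Phi> \<subseteq> spine k C V \<Psi>"
  unfolding spine_def by blast

lemma cstar_attained:
  assumes "finite F" "F \<noteq> {}"
  obtains G where "G \<noteq> {}" "G \<subseteq> F" "cstar F = real (card G) / real (card (vars G))"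
proof -
  let ?S = "{real (card G) / real (card (vars G)) | G. G \<noteq> {} \<and> G \<subseteq> F}"
  have "?S = (\<lambda>G. real (card G) / real (card (vars G))) ` {G. G \<noteq> {} \<and> G \<subseteq> F}"
    by blast
  then have "finite ?S" using assms by simp
  moreover have "?S \<noteq> {}" using assms by blast
  ultimately have "cstar F \<in> ?S" unfolding cstar_def by (rule Max_in)
  then show ?thesis using that by blast
qed

section \<open>Binomial estimates and the first-moment term\<close>

lemma pow_le_fact_exp:
  fixes x :: real
  assumes "0 \<le> x"
  shows "x ^ n \<le> fact n * exp x"
proof -
  have "sum (\<lambda>i. x ^ i /\<^sub>R fact i) {n} \<le> (\<Sum>i. x ^ i /\<^sub>R fact i)"
    using assms by (intro sum_le_suminf sums_summable[OF exp_converges]) auto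
  also have "\<dots> = exp x" by (rule sums_unique[OF exp_converges, symmetric])
  finally show ?thesis by (simp add: field_simps)
qed

text \<open>Combines m^m \<le> m! e^m, one term of the exponential series, with (N choose m) m!
  \<le> N^m.\<close>

lemma binomial_le_exp_pow:
  assumes "0 < m"
  shows "real (N choose m) \<le> (exp 1 * real N / real m) ^ m"
proof -
  have "real (N choose m) * real m ^ m \<le> real (N choose m) * (fact m * exp (real m))"
    by (intro mult_left_mono pow_le_fact_exp) auto
  also have "\<dots> = real ((N choose m) * fact m) * exp (real m)" by simp
  also have "\<dots> \<le> real (N ^ m) * exp (real m)"
    by (intro mult_right_mono) (use binomial_fact_pow in \<open>simp_all only: of_nat_le_iff exp_ge_zero\<close>)
  also have "\<dots> = (exp 1 * real N) ^ m"
    by (simp add: power_mult_distrib exp_of_nat_mult[symmetric])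
  finally show ?thesis using assms by (simp add: power_divide field_simps)
qed

text \<open>For \<open>k \<le> n\<close> the ratio of the binomials is the product of (v - i)/(n -
  i) over i < k, each factor being at most v/n. Denominators are cleared so that the induction stays
  in the naturals.\<close>

lemma binomial_ratio_le_pow:
  assumes "v \<le> n"
  shows "(v choose k) * n ^ k \<le> (n choose k) * v ^ k"
proof (induction k)
  case (Suc k)
  have "(v - k) * n \<le> (n - k) * v"
    using assms by (simp add: diff_mult_distrib mult.commute[of v n] diff_le_mono2)
  from mult_le_mono[OF Suc.IH this]
  have "((v - k) * (v choose k)) * n ^ Suc k \<le> ((n - k) * (n choose k)) * v ^ Suc k"
    by (simp add: mult_ac)
  moreover have "(a - k) * (a choose k) = Suc k * (a choose Suc k)" for a
    by (simp only: binomial_absorb_comp binomial_absorption)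
  ultimately have "Suc k * ((v choose Suc k) * n ^ Suc k) \<le> Suc k * ((n choose Suc k) * v ^ Suc k)"
    by (simp only: mult.assoc)
  then show ?case by (simp only: Suc_mult_le_cancel1)
qed simp

lemma sum_div_two_power_le: "(\<Sum>v\<le>N. real v * (1/2) ^ v) \<le> 2"
proof -
  have "(\<Sum>v\<le>N. real v * (1/2) ^ v) = 2 - (real N + 2) * (1/2) ^ N"
    by (induction N) (auto simp: field_simps)
  then show ?thesis by simp
qed

text \<open>With r = v/n, the choice of variables costs (e/r)^v and the choice of constraints
  (B/r)^m, so the term is at most (e/r)^v (B r^(k-1))^m. Replacing m by (1 + \<epsilon>) v/(k - 1)
  leaves a bound of the form (A r^\<epsilon>)^v: the excess \<epsilon> is what beats the number of
  variable sets.\<close>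

lemma first_moment_term_bound:
  assumes k: "2 \<le> k" and e: "0 < \<epsilon>" "\<epsilon> \<le> 1" and K: "0 < K"
  obtains \<delta> A :: real where "0 < \<delta>" "\<delta> \<le> 1" "0 < A"
    "\<And>n v M m. \<lbrakk>0 < v; real v \<le> \<delta> * real n; real M \<le> K * real n;
        (1 + \<epsilon>) / (real k - 1) * real v \<le> real m\<rbrakk> \<Longrightarrow>
      real (n choose v) * (real (M choose m) * ((real v / real n) ^ k) ^ m)
        \<le> A * real n powr (- \<epsilon>) * (real v * (1/2) ^ v)"
proof -
  \<comment> \<open>\<open>\<beta>\<close> is the density, with (k - 1) \<beta> = 1 + \<epsilon>;
    \<open>B\<close> is chosen so that e M/m \<le> B/r; \<open>\<delta>\<close> ensures both B r
    \<le> 1 and A r^\<epsilon> \<le> 1/2 for all r \<le> \<delta>.\<close>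
  define \<beta> where "\<beta> = (1 + \<epsilon>) / (real k - 1)"
  define B where "B = exp 1 * K * (real k - 1)"
  define A where "A = exp 1 * B powr \<beta>"
  define \<delta> where "\<delta> = min 1 (min (1 / B) ((1 / (2 * A)) powr (1 / \<epsilon>)))"
  have k1: "0 < real k - 1" using k by simp
  have pos: "0 < \<beta>" "0 < B" "0 < A" "0 < \<delta>"
    using k1 e K by (simp_all add: \<beta>_def B_def A_def \<delta>_def)
  have "\<delta> \<le> 1" "\<delta> \<le> 1 / B" by (simp_all add: \<delta>_def)
  have "A * \<delta> powr \<epsilon> \<le> A * ((1 / (2 * A)) powr (1 / \<epsilon>)) powr \<epsilon>"
    using pos e by (intro mult_left_mono powr_mono2) (auto simp: \<delta>_def)
  also have "\<dots> = 1 / 2" using pos e by (simp add: powr_powr)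
  finally have A\<delta>: "A * \<delta> powr \<epsilon> \<le> 1 / 2" .
  have "real (n choose v) * (real (M choose m) * ((real v / real n) ^ k) ^ m)
        \<le> 2 * A * real n powr (- \<epsilon>) * (real v * (1/2) ^ v)"
    if v: "0 < v" and vn: "real v \<le> \<delta> * real n" and M: "real M \<le> K * real n"
      and m: "(1 + \<epsilon>) / (real k - 1) * real v \<le> real m" for n v M m
  proof -
    define r where "r = real v / real n"
    have n: "0 < n" using v vn by (cases n) auto
    have r: "0 < r" "r \<le> \<delta>" using v vn n by (simp_all add: r_def field_simps)
    have r1: "r \<le> 1" using r \<open>\<delta> \<le> 1\<close> by simp
    have m\<beta>: "\<beta> * real v \<le> real m" using m by (simp add: \<beta>_def)
    then have m0: "0 < m" using mult_pos_pos[OF \<open>0 < \<beta>\<close>, of "real v"] v by simp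
    \<comment> \<open>Weaker than the density condition, but enough to trade m for v in e
      M/m.\<close>
    have vm: "real v \<le> (real k - 1) * real m"
    proof -
      have "real v \<le> (1 + \<epsilon>) * real v" using e by (simp add: distrib_right)
      also have "\<dots> \<le> (real k - 1) * real m" using m k1 by (simp add: field_simps)
      finally show ?thesis .
    qed
    \<comment> \<open>\<open>y\<close> is the combined base of the m-th power; k \<ge> 2 gives y
      \<le> B r \<le> 1.\<close>
    define y where "y = B * r ^ (k - 1)"
    have "r ^ (k - 1) \<le> r ^ 1" using r r1 k by (intro power_decreasing) auto
    then have "y \<le> B * r" using pos by (simp add: y_def)
    also have "\<dots> \<le> 1" 
      using mult_left_mono[of r "1 / B" B] r \<open>\<delta> \<le> 1 / B\<close> pos by simp
    finally have y: "0 < y" "y \<le> 1" using pos r by (simp_all add: y_def)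
    have "real (M choose m) \<le> (exp 1 * real M / real m) ^ m" by (rule binomial_le_exp_pow[OF m0])
    also have "\<dots> \<le> (B / r) ^ m"
    proof (rule power_mono)
      have "real M * real v \<le> (K * real n) * ((real k - 1) * real m)"
        using M vm K by (intro mult_mono) auto
      then have "real M / real m \<le> K * (real k - 1) * real n / real v"
        using m0 v by (simp add: field_simps)
      then have "exp 1 * (real M / real m) \<le> exp 1 * (K * (real k - 1) * real n / real v)"
        by (intro mult_left_mono) auto
      then show "exp 1 * real M / real m \<le> B / r" by (simp add: B_def r_def mult_ac)
    qed simp
    finally have "real (M choose m) * (r ^ k) ^ m \<le> (B / r) ^ m * (r ^ k) ^ m"
      using r by (intro mult_right_mono) auto
    also have "\<dots> = y ^ m"
    proof -
      have "r ^ k = r * r ^ (k - 1)" using k by (cases k) auto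
      then show ?thesis using r by (simp add: y_def flip: power_mult_distrib)
    qed
    also have "\<dots> = y powr real m" using y by (simp add: powr_realpow)
    \<comment> \<open>Since y \<le> 1, lowering the exponent from m to \<beta> v only enlarges the
      power.\<close>
    also have "\<dots> \<le> y powr (\<beta> * real v)" using y m\<beta> by (intro powr_mono') auto
    also have "\<dots> = (y powr \<beta>) ^ v" using y by (simp add: powr_powr[symmetric] powr_realpow)
    also have "y powr \<beta> = B powr \<beta> * r powr (1 + \<epsilon>)"
    proof -
      have "r ^ (k - 1) = r powr (real k - 1)"
        using r k by (simp add: powr_realpow[symmetric] of_nat_diff)
      then have "y powr \<beta> = B powr \<beta> * r powr ((real k - 1) * \<beta>)"
        using pos r by (simp add: y_def powr_mult powr_powr)
      then show ?thesis using k1 by (simp add: \<beta>_def)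
    qed
    finally have bM: "real (M choose m) * (r ^ k) ^ m \<le> (B powr \<beta> * r powr (1 + \<epsilon>)) ^ v" .
    have "real (n choose v) \<le> (exp 1 / r) ^ v"
      using binomial_le_exp_pow[OF v, of n] by (simp add: r_def)
    then have "real (n choose v) * (real (M choose m) * (r ^ k) ^ m)
        \<le> (exp 1 / r) ^ v * (B powr \<beta> * r powr (1 + \<epsilon>)) ^ v"
      using bM r by (intro mult_mono) auto
    also have "\<dots> = (A * r powr \<epsilon>) ^ v"
      using r by (simp add: A_def powr_add mult.assoc flip: power_mult_distrib)
    \<comment> \<open>One factor is kept apart to supply n^(-\<epsilon>); the others are bounded by
      1/2, which makes the sum over v converge.\<close>
    also have "\<dots> = (A * r powr \<epsilon>) * (A * r powr \<epsilon>) ^ (v - 1)"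
      using v by (simp add: power_eq_if)
    also have "\<dots> \<le> (A * r powr \<epsilon>) * (1/2) ^ (v - 1)"
    proof (intro mult_left_mono power_mono)
      have "A * r powr \<epsilon> \<le> A * \<delta> powr \<epsilon>"
        using r pos e by (intro mult_left_mono powr_mono2) auto
      then show "A * r powr \<epsilon> \<le> 1 / 2" using A\<delta> by simp
    qed (use pos in auto)
    also have "\<dots> = 2 * A * real n powr (- \<epsilon>) * (real v powr \<epsilon> * (1/2) ^ v)"
    proof -
      have "(1/2 :: real) ^ (v - 1) = 2 * (1/2) ^ v" using v by (cases v) auto
      moreover have "r powr \<epsilon> = real n powr (- \<epsilon>) * real v powr \<epsilon>"
        by (simp add: r_def powr_divide powr_minus_divide)
      ultimately show ?thesis by (simp only: mult_ac)
    qed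
    also have "\<dots> \<le> 2 * A * real n powr (- \<epsilon>) * (real v * (1/2) ^ v)"
    proof (intro mult_left_mono mult_right_mono)
      \<comment> \<open>Here \<epsilon> \<le> 1 enters: v^\<epsilon> is relaxed to v, so that the
        later sum has a closed form.\<close>
      show "real v powr \<epsilon> \<le> real v" using powr_mono[of \<epsilon> 1 "real v"] e v by simp
    qed (use pos in simp_all)
    finally show ?thesis by (simp only: r_def)
  qed
  then show thesis
    by (rule that[of \<delta> "2 * A", OF \<open>0 < \<delta>\<close> \<open>\<delta> \<le> 1\<close> mult_pos_pos[OF zero_less_numeral \<open>0 < A\<close>]])
qed

section \<open>Independent draws and the random clause\<close>

text \<open>Cutting both sets down to the supports makes them countable, as the product rule
  requires.\<close>

lemma prob_pair_pmf_times:
  "measure_pmf.prob (pair_pmf p q) (A \<times> B) = measure_pmf.prob p A * measure_pmf.prob q B"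
proof -
  have "measure_pmf.prob (pair_pmf p q) (A \<times> B)
      = measure_pmf.prob (pair_pmf p q) ((A \<inter> set_pmf p) \<times> (B \<inter> set_pmf q))"
    by (subst measure_Int_set_pmf[symmetric]) (simp add: Times_Int_Times)
  also have "\<dots> = measure_pmf.prob p (A \<inter> set_pmf p) * measure_pmf.prob q (B \<inter> set_pmf q)"
    by (intro measure_pmf_prob_product) auto
  finally show ?thesis by (simp only: measure_Int_set_pmf)
qed

lemma replicate_pmf_Suc_pair:
  "replicate_pmf (Suc M) p = map_pmf (\<lambda>(x, xs). x # xs) (pair_pmf p (replicate_pmf M p))"
  by (simp add: pair_pmf_def map_bind_pmf)

text \<open>Union bound over the m positions of the successes. In the induction either the first
  entry succeeds together with m - 1 of the rest, or m of the rest succeed; Pascal's rule adds the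
  two bounds.\<close>

lemma prob_many_successes_le:
  "measure_pmf.prob (replicate_pmf M p) {xs. m \<le> length (filter Q xs)}
     \<le> real (M choose m) * measure_pmf.prob p {x. Q x} ^ m"
proof (induction M arbitrary: m)
  case 0
  then show ?case by (cases m) (auto simp: measure_return_pmf)
next
  case (Suc M)
  show ?case
  proof (cases m)
    case m: (Suc m')
    let ?q = "measure_pmf.prob p {x. Q x}"
    let ?E = "\<lambda>m. {xs. m \<le> length (filter Q xs)}"
    have "measure_pmf.prob (replicate_pmf (Suc M) p) (?E m)
        \<le> measure_pmf.prob (pair_pmf p (replicate_pmf M p))
             ({x. Q x} \<times> ?E m' \<union> UNIV \<times> ?E m)"
      unfolding replicate_pmf_Suc_pair measure_map_pmf
      by (intro measure_pmf.finite_measure_mono) (auto simp: m split: if_splits)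
    also have "\<dots> \<le> measure_pmf.prob (pair_pmf p (replicate_pmf M p)) ({x. Q x} \<times> ?E m')
        + measure_pmf.prob (pair_pmf p (replicate_pmf M p)) (UNIV \<times> ?E m)"
      by (intro measure_Un_le) auto
    also have "\<dots> = ?q * measure_pmf.prob (replicate_pmf M p) (?E m')
        + measure_pmf.prob (replicate_pmf M p) (?E m)"
      by (simp add: prob_pair_pmf_times)
    also have "\<dots> \<le> ?q * (real (M choose m') * ?q ^ m') + real (M choose m) * ?q ^ m"
      by (intro add_mono mult_left_mono Suc.IH) auto
    also have "\<dots> = real (Suc M choose m) * ?q ^ m"
      by (simp add: m algebra_simps)
    finally show ?thesis .
  qed simp
qed

text \<open>Coupling: one more draw inserts an independent clause into the formula, and an event
  closed under insertion survives it.\<close>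

lemma prob_random_formula_mono:
  assumes up: "\<And>F c. F \<in> A \<Longrightarrow> insert c F \<in> A" and "M \<le> M'"
  shows "measure_pmf.prob (random_formula k P n M) A \<le> measure_pmf.prob (random_formula k P n M') A"
proof -
  let ?c = "random_clause k P n"
  let ?f = "\<lambda>M. measure_pmf.prob (random_formula k P n M) A"
  have "?f N \<le> ?f (Suc N)" for N
  proof -
    have "?f N = measure_pmf.prob (pair_pmf ?c (replicate_pmf N ?c)) (UNIV \<times> (set -` A))"
      by (simp add: random_formula_def prob_pair_pmf_times)
    also have "\<dots> \<le> ?f (Suc N)"
      unfolding random_formula_def replicate_pmf_Suc_pair measure_map_pmf
      by (intro measure_pmf.finite_measure_mono) (auto intro: up)
    finally show ?thesis .
  qed
  then show ?thesis using \<open>M \<le> M'\<close> by (rule lift_Suc_mono_le)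
qed

lemma k_subsets_finite_nonempty:
  assumes "k \<le> n"
  shows "finite {S. S \<subseteq> {..<n::nat} \<and> card S = k}" "{S. S \<subseteq> {..<n::nat} \<and> card S = k} \<noteq> {}"
proof -
  show "finite {S. S \<subseteq> {..<n::nat} \<and> card S = k}" by simp
  show "{S. S \<subseteq> {..<n::nat} \<and> card S = k} \<noteq> {}"
    using assms by (auto intro!: exI[of _ "{..<k}"])
qed

text \<open>Forgetting the ordering of the variables leaves two independent components, so that
  probabilities factor.\<close>

lemma map_set_random_clause:
  assumes "k \<le> n"
  shows "map_pmf (\<lambda>(R, xs). (set xs, R)) (random_clause k P n)
       = pair_pmf (pmf_of_set {S. S \<subseteq> {..<n} \<and> card S = k}) P"
proof -
  let ?U = "{S. S \<subseteq> {..<n} \<and> card S = k}"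
  have "map_pmf (\<lambda>(R, xs). (set xs, R)) (random_clause k P n)
      = do {S \<leftarrow> pmf_of_set ?U; xs \<leftarrow> pmf_of_set (permutations_of_set S); R \<leftarrow> P;
            return_pmf (set xs, R)}"
    by (simp add: random_clause_def map_bind_pmf)
  also have "\<dots> = do {S \<leftarrow> pmf_of_set ?U; xs \<leftarrow> pmf_of_set (permutations_of_set S); R \<leftarrow> P;
            return_pmf (S, R)}"
  proof (intro bind_pmf_cong refl)
    fix S xs R
    assume "S \<in> set_pmf (pmf_of_set ?U)" and xs: "xs \<in> set_pmf (pmf_of_set (permutations_of_set S))"
    then have "finite S"
      using k_subsets_finite_nonempty[OF assms] by (auto intro: finite_subset)
    then have "xs \<in> permutations_of_set S" using xs by simp
    then have "set xs = S" by (rule permutations_of_setD)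
    then show "return_pmf (set xs, R) = return_pmf (S, R)" by simp
  qed
  also have "\<dots> = pair_pmf (pmf_of_set ?U) P" by (simp add: pair_pmf_def)
  finally show ?thesis .
qed

text \<open>Serves for two kinds of \<open>D\<close>: all constraints, when dense spots are counted,
  and a singleton, when a violated constraint is sought.\<close>

lemma prob_random_clause_within:
  assumes "k \<le> n" "V \<subseteq> {..<n}"
  shows "measure_pmf.prob (random_clause k P n) {c. set (snd c) \<subseteq> V \<and> fst c \<in> D}
       = real (card V choose k) / real (n choose k) * measure_pmf.prob P D"
proof -
  let ?U = "{S. S \<subseteq> {..<n} \<and> card S = k}"
  have "measure_pmf.prob (random_clause k P n) {c. set (snd c) \<subseteq> V \<and> fst c \<in> D}
      = measure_pmf.prob (map_pmf (\<lambda>(R, xs). (set xs, R)) (random_clause k P n)) ({S. S \<subseteq> V} \<times> D)"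
    by (auto intro!: arg_cong[of _ _ "measure _"])
  also have "\<dots> = measure_pmf.prob (pmf_of_set ?U) {S. S \<subseteq> V} * measure_pmf.prob P D"
    by (simp only: map_set_random_clause[OF assms(1)] prob_pair_pmf_times)
  also have "?U \<inter> {S. S \<subseteq> V} = {S. S \<subseteq> V \<and> card S = k}"
    using assms(2) by auto
  then have "measure_pmf.prob (pmf_of_set ?U) {S. S \<subseteq> V}
      = real (card V choose k) / real (n choose k)"
    using k_subsets_finite_nonempty[OF assms(1)] n_subsets[of "{..<n}" k]
      n_subsets[of V k] finite_subset[OF assms(2)]
    by (subst measure_pmf_of_set) simp_all
  finally show ?thesis .
qed

lemma set_random_clause:
  assumes "k \<le> n"
  shows "set_pmf (random_clause k P n) \<subseteq> set_pmf P \<times> var_tuples k {..<n}"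
proof
  fix c assume "c \<in> set_pmf (random_clause k P n)"
  then obtain S xs R where c: "c = (R, xs)" "R \<in> set_pmf P"
    and S: "S \<in> set_pmf (pmf_of_set {S. S \<subseteq> {..<n} \<and> card S = k})"
    and xs: "xs \<in> set_pmf (pmf_of_set (permutations_of_set S))"
    unfolding random_clause_def by auto
  have S: "S \<subseteq> {..<n}" "card S = k" "finite S"
    using S k_subsets_finite_nonempty[OF assms] by (auto intro: finite_subset)
  then have "xs \<in> permutations_of_set S" using xs by simp
  then have "set xs = S" "distinct xs" by (rule permutations_of_setD)+
  then show "c \<in> set_pmf P \<times> var_tuples k {..<n}"
    using S c distinct_card[of xs] by (auto simp: var_tuples_def)
qed

lemma set_random_formula:
  assumes "k \<le> n" "\<Phi> \<in> set_pmf (random_formula k P n M)"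
  shows "finite \<Phi>" "\<Phi> \<subseteq> set_pmf P \<times> var_tuples k {..<n}"
proof -
  obtain xs where "\<Phi> = set xs" "xs \<in> lists (set_pmf (random_clause k P n))"
    using assms(2) by (auto simp: random_formula_def set_replicate_pmf)
  then show "finite \<Phi>" "\<Phi> \<subseteq> set_pmf P \<times> var_tuples k {..<n}"
    using set_random_clause[OF assms(1), of P] by auto
qed

section \<open>Absence of small dense subformulas\<close>

text \<open>The variable set is required to lie in \<open>{..<n}\<close> so that a union bound over it is possible.\<close>

definition locally_dense :: "real \<Rightarrow> real \<Rightarrow> nat \<Rightarrow> clause set \<Rightarrow> bool" where
  "locally_dense \<alpha> b n \<Phi> \<longleftrightarrow> (\<exists>G\<subseteq>\<Phi>. vars G \<subseteq> {..<n} \<and> 0 < card (vars G) \<and>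
     real (card (vars G)) \<le> b \<and> \<alpha> * real (card (vars G)) < real (card G))"

text \<open>Union bound over the sizes v and the variable sets of size v; a dense spot on such a set
  forces at least \<alpha> v of the M draws into it. \<open>\<delta>\<close> and \<open>A\<close>
  are obtained before \<open>P\<close>, \<open>n\<close> and \<open>M\<close>, so the bound is
  uniform in these.\<close>

lemma prob_locally_dense_le:
  assumes k: "2 \<le> k" and e: "0 < \<epsilon>" "\<epsilon> \<le> 1" and K: "0 < K"
  obtains \<delta> A :: real where "0 < \<delta>" "\<delta> \<le> 1"
    "\<And>P n M. \<lbrakk>k \<le> n; real M \<le> K * real n\<rbrakk> \<Longrightarrow>
       measure_pmf.prob (random_formula k P n M)
         {\<Phi>. locally_dense ((1 + \<epsilon>) / (real k - 1)) (\<delta> * real n) n \<Phi>} \<le> A * real n powr (- \<epsilon>)"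
proof -
  obtain \<delta> A :: real where \<delta>: "0 < \<delta>" "\<delta> \<le> 1" and A: "0 < A"
    and bound: "\<And>n v M m. \<lbrakk>0 < v; real v \<le> \<delta> * real n; real M \<le> K * real n;
        (1 + \<epsilon>) / (real k - 1) * real v \<le> real m\<rbrakk> \<Longrightarrow>
      real (n choose v) * (real (M choose m) * ((real v / real n) ^ k) ^ m)
        \<le> A * real n powr (- \<epsilon>) * (real v * (1/2) ^ v)"
    using first_moment_term_bound[OF k e K] by metis
  define \<alpha> where "\<alpha> = (1 + \<epsilon>) / (real k - 1)"
  have "measure_pmf.prob (random_formula k P n M) {\<Phi>. locally_dense \<alpha> (\<delta> * real n) n \<Phi>}
      \<le> 2 * A * real n powr (- \<epsilon>)"
    if n: "k \<le> n" and M: "real M \<le> K * real n" for P n M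
  proof -
    let ?r = "replicate_pmf M (random_clause k P n)"
    \<comment> \<open>Rounding up loses nothing: a cardinality above \<alpha> v is at least
      \<open>m v\<close>.\<close>
    define m where "m v = nat \<lceil>\<alpha> * real v\<rceil>" for v
    define W where "W = {v. v \<le> n \<and> 0 < v \<and> real v \<le> \<delta> * real n}"
    define U where "U v = {V. V \<subseteq> {..<n} \<and> card V = v}" for v
    define E where "E V = {xs. m (card V) \<le> length (filter (\<lambda>c :: clause. set (snd c) \<subseteq> V) xs)}" for V
    have fin: "finite W" "finite (U v)" for v by (simp_all add: W_def U_def)
    have "set -` {\<Phi>. locally_dense \<alpha> (\<delta> * real n) n \<Phi>} \<subseteq> (\<Union>v\<in>W. \<Union>V\<in>U v. E V)"
    proof
      fix xs assume "xs \<in> set -` {\<Phi>. locally_dense \<alpha> (\<delta> * real n) n \<Phi>}"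
      then obtain G where G: "G \<subseteq> set xs" "vars G \<subseteq> {..<n}" "0 < card (vars G)"
        "real (card (vars G)) \<le> \<delta> * real n" "\<alpha> * real (card (vars G)) < real (card G)"
        by (auto simp: locally_dense_def)
      \<comment> \<open>Repeated draws of a clause collapse in the set, so the number of list
        positions bounds \<open>card G\<close> from above.\<close>
      have "G \<subseteq> set (filter (\<lambda>c. set (snd c) \<subseteq> vars G) xs)"
        using G(1) by (auto simp: vars_def)
      then have "card G \<le> length (filter (\<lambda>c. set (snd c) \<subseteq> vars G) xs)"
        by (meson List.finite_set card_mono card_length le_trans)
      then have "xs \<in> E (vars G)" using G(5) by (simp add: E_def m_def)
      moreover have "card (vars G) \<in> W"
        using G card_mono[OF _ G(2)] by (simp add: W_def)
      moreover have "vars G \<in> U (card (vars G))" using G(2) by (simp add: U_def)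
      ultimately show "xs \<in> (\<Union>v\<in>W. \<Union>V\<in>U v. E V)" by blast
    qed
    then have "measure_pmf.prob (random_formula k P n M) {\<Phi>. locally_dense \<alpha> (\<delta> * real n) n \<Phi>}
        \<le> measure_pmf.prob ?r (\<Union>v\<in>W. \<Union>V\<in>U v. E V)"
      unfolding random_formula_def measure_map_pmf by (intro measure_pmf.finite_measure_mono) auto
    also have "\<dots> \<le> (\<Sum>v\<in>W. measure_pmf.prob ?r (\<Union>V\<in>U v. E V))"
      using fin by (intro measure_UNION_le) auto
    also have "\<dots> \<le> (\<Sum>v\<in>W. A * real n powr (- \<epsilon>) * (real v * (1/2) ^ v))"
    proof (rule sum_mono)
      fix v assume v: "v \<in> W"
      have E: "measure_pmf.prob ?r (E V) \<le> real (M choose m v) * ((real v / real n) ^ k) ^ m v"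
        if V: "V \<in> U v" for V
      proof -
        have cV: "card V = v" "V \<subseteq> {..<n}" using V by (simp_all add: U_def)
        have "v \<le> n" using v by (simp add: W_def)
        have "measure_pmf.prob (random_clause k P n) {c. set (snd c) \<subseteq> V}
            = real (v choose k) / real (n choose k)"
          using prob_random_clause_within[OF n cV(2), of P UNIV] cV by simp
        also have "\<dots> \<le> (real v / real n) ^ k"
        proof -
          have "real (v choose k) * real n ^ k \<le> real (n choose k) * real v ^ k"
            using binomial_ratio_le_pow[OF \<open>v \<le> n\<close>, of k] by (metis of_nat_le_iff of_nat_mult of_nat_power)
          moreover have "0 < n choose k" "0 < n" using n k by auto
          ultimately show ?thesis by (simp add: power_divide field_simps)
        qed
        finally have q: "measure_pmf.prob (random_clause k P n) {c. set (snd c) \<subseteq> V}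
            \<le> (real v / real n) ^ k" .
        have "measure_pmf.prob ?r (E V)
            \<le> real (M choose m v) * measure_pmf.prob (random_clause k P n) {c. set (snd c) \<subseteq> V} ^ m v"
          unfolding E_def cV by (rule prob_many_successes_le)
        also have "\<dots> \<le> real (M choose m v) * ((real v / real n) ^ k) ^ m v"
          using q by (intro mult_left_mono power_mono) auto
        finally show ?thesis .
      qed
      have "measure_pmf.prob ?r (\<Union>V\<in>U v. E V) \<le> (\<Sum>V\<in>U v. measure_pmf.prob ?r (E V))"
        using fin by (intro measure_UNION_le) auto
      also have "\<dots> \<le> (\<Sum>V\<in>U v. real (M choose m v) * ((real v / real n) ^ k) ^ m v)"
        by (intro sum_mono E)
      also have "\<dots> = real (n choose v) * (real (M choose m v) * ((real v / real n) ^ k) ^ m v)"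
        using n_subsets[of "{..<n}" v] by (simp add: U_def)
      also have "\<dots> \<le> A * real n powr (- \<epsilon>) * (real v * (1/2) ^ v)"
        using v M by (intro bound) (auto simp: W_def m_def \<alpha>_def real_nat_ceiling_ge)
      finally show "measure_pmf.prob ?r (\<Union>V\<in>U v. E V) \<le> A * real n powr (- \<epsilon>) * (real v * (1/2) ^ v)" .
    qed
    also have "\<dots> = A * real n powr (- \<epsilon>) * (\<Sum>v\<in>W. real v * (1/2) ^ v)"
      by (simp only: sum_distrib_left)
    also have "\<dots> \<le> A * real n powr (- \<epsilon>) * 2"
    proof (rule mult_left_mono)
      have "(\<Sum>v\<in>W. real v * (1/2) ^ v) \<le> (\<Sum>v\<le>n. real v * (1/2) ^ v)"
        by (intro sum_mono2) (auto simp: W_def)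
      then show "(\<Sum>v\<in>W. real v * (1/2) ^ v) \<le> 2" using sum_div_two_power_le[of n] by linarith
    qed (use A in simp)
    finally show ?thesis by (simp only: mult_ac)
  qed
  then show thesis unfolding \<alpha>_def by (rule that[OF \<delta>])
qed

section \<open>Unsatisfiability at large linear density\<close>

lemma prob_sat_eq_1:
  assumes "k \<le> n" "\<forall>R\<in>set_pmf P. replicate k b \<in> R"
  shows "prob_sat k P n M = 1"
  unfolding prob_sat_def
proof (rule measure_pmf.prob_eq_1[THEN iffD2]; (intro AE_pmfI)?)
  fix \<Phi> assume "\<Phi> \<in> set_pmf (random_formula k P n M)"
  then have "\<Phi> \<subseteq> set_pmf P \<times> var_tuples k {..<n}" using set_random_formula assms(1) by blast
  then have "map (\<lambda>_. b) xs \<in> R" if "(R, xs) \<in> \<Phi>" for R xs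
    using that assms(2) by (auto simp: var_tuples_def map_replicate_const)
  then show "\<Phi> \<in> {\<Phi>. satisfiable \<Phi>}"
    unfolding satisfiable_def by auto
qed simp

text \<open>Union bound over the assignments, each coded by the set \<open>T\<close> of true
  variables. Asking for as many successes as draws makes the binomial coefficient 1.\<close>

lemma prob_sat_le:
  assumes "k \<le> n"
    and s: "\<And>\<sigma>. measure_pmf.prob (random_clause k P n) {c. map \<sigma> (snd c) \<in> fst c} \<le> s"
  shows "prob_sat k P n M \<le> 2 ^ n * s ^ M"
proof -
  let ?r = "replicate_pmf M (random_clause k P n)"
  let ?Q = "\<lambda>T c. map (\<lambda>i. i \<in> T) (snd c) \<in> fst c"
  let ?E = "\<lambda>T. {xs. M \<le> length (filter (?Q T) xs)}"
  have "prob_sat k P n M = measure_pmf.prob ?r ({xs. satisfiable (set xs)} \<inter> set_pmf ?r)"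
    by (simp add: prob_sat_def random_formula_def measure_Int_set_pmf vimage_def)
  also have "\<dots> \<le> measure_pmf.prob ?r (\<Union>T\<in>Pow {..<n}. ?E T)"
  proof (intro measure_pmf.finite_measure_mono subsetI)
    fix xs assume "xs \<in> {xs. satisfiable (set xs)} \<inter> set_pmf ?r"
    then obtain \<sigma> where \<sigma>: "\<forall>(R, ys)\<in>set xs. map \<sigma> ys \<in> R"
      and len: "length xs = M" and sub: "set xs \<subseteq> set_pmf (random_clause k P n)"
      by (auto simp: satisfiable_def set_replicate_pmf)
    \<comment> \<open>Values outside \<open>{..<n}\<close> do not affect the formula, which leaves
      2^n assignments.\<close>
    let ?T = "{i \<in> {..<n}. \<sigma> i}"
    have "?Q ?T c" if "c \<in> set xs" for c
    proof -
      have "set (snd c) \<subseteq> {..<n}"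
        using set_random_clause[OF assms(1), of P] sub that unfolding var_tuples_def by fastforce
      then have "map (\<lambda>i. i \<in> ?T) (snd c) = map \<sigma> (snd c)" by auto
      moreover have "map \<sigma> (snd c) \<in> fst c" using \<sigma> that by (auto simp: case_prod_beta)
      ultimately show ?thesis by (simp only:)
    qed
    then have "filter (?Q ?T) xs = xs" by (intro filter_True) blast
    then have "xs \<in> ?E ?T" using len by simp
    moreover have "?T \<in> Pow {..<n}" by auto
    ultimately show "xs \<in> (\<Union>T\<in>Pow {..<n}. ?E T)" by (intro UN_I[where a = ?T])
  qed simp
  also have "\<dots> \<le> (\<Sum>T\<in>Pow {..<n}. measure_pmf.prob ?r (?E T))"
    by (intro measure_UNION_le) auto
  also have "\<dots> \<le> (\<Sum>T\<in>Pow {..<n}. s ^ M)"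
  proof (rule sum_mono)
    fix T
    have "measure_pmf.prob ?r (?E T)
        \<le> real (M choose M) * measure_pmf.prob (random_clause k P n) {c. ?Q T c} ^ M"
      by (rule prob_many_successes_le)
    also have "\<dots> \<le> s ^ M" using s[of "\<lambda>i. i \<in> T"] by (simp add: power_mono)
    finally show "measure_pmf.prob ?r (?E T) \<le> s ^ M" .
  qed
  also have "\<dots> = 2 ^ n * s ^ M" by (simp add: card_Pow)
  finally show ?thesis .
qed

text \<open>
  If every constraint allowed the all-\<open>b\<close> assignment, all formulas would be satisfiable. Otherwise a
  constraint forbidding it, placed on the variables where the majority value \<open>b\<close> of a given assignment is
  taken, violates that assignment with probability bounded away from 0.
\<close>

lemma prob_clause_satisfied_le:
  assumes k: "0 < k" and n: "2 * k \<le> n"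
    and D: "\<And>b. D b \<in> set_pmf P \<and> replicate k b \<notin> D b"
    and p: "\<And>b. p \<le> pmf P (D b)" "0 \<le> p"
  shows "measure_pmf.prob (random_clause k P n) {c. map \<sigma> (snd c) \<in> fst c}
       \<le> 1 - (1 / (2 * real k)) ^ k * p"
proof -
  let ?Z = "\<lambda>b. {i \<in> {..<n}. \<sigma> i = b}"
  have "card (?Z True) + card (?Z False) = card (?Z True \<union> ?Z False)"
    by (subst card_Un_disjoint) auto
  also have "?Z True \<union> ?Z False = {..<n}" by auto
  finally have "card (?Z True) + card (?Z False) = n" by simp
  then have "n \<le> 2 * card (?Z True) \<or> n \<le> 2 * card (?Z False)" by linarith
  then obtain b where b: "n \<le> 2 * card (?Z b)" by (elim disjE)
  define z where "z = card (?Z b)"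
  have z: "k \<le> z" "n \<le> 2 * z" "k \<le> n" using b n by (simp_all add: z_def)
  let ?B = "{c. set (snd c) \<subseteq> ?Z b \<and> fst c \<in> {D b}}"
  \<comment> \<open>From z \<ge> n/2, (z choose k) \<ge> (z/k)^k and (n choose k) \<le> n^k comes a
    constant independent of n and \<sigma>.\<close>
  have "(1 / (2 * real k)) ^ k \<le> (real z / real k) ^ k / real n ^ k"
  proof -
    have "1 / (2 * real k) \<le> (real z / real k) / real n"
      using z k by (simp add: field_simps)
    then show ?thesis by (simp only: flip: power_divide) (intro power_mono; simp)
  qed
  also have "\<dots> \<le> real (z choose k) / real (n choose k)"
  proof (intro frac_le)
    show "(real z / real k) ^ k \<le> real (z choose k)" by (rule binomial_ge_n_over_k_pow_k[OF z(1)])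
    show "real (n choose k) \<le> real n ^ k"
      using binomial_le_pow[OF z(3)] by (metis of_nat_le_iff of_nat_power)
  qed (use z in auto)
  finally have "(1 / (2 * real k)) ^ k * p \<le> real (z choose k) / real (n choose k) * pmf P (D b)"
    using p by (intro mult_mono) auto
  also have "\<dots> = measure_pmf.prob (random_clause k P n) ?B"
    by (subst prob_random_clause_within[OF z(3)]) (auto simp: z_def measure_pmf_single)
  finally have B: "(1 / (2 * real k)) ^ k * p \<le> measure_pmf.prob (random_clause k P n) ?B" .
  have "measure_pmf.prob (random_clause k P n) {c. map \<sigma> (snd c) \<in> fst c}
      \<le> measure_pmf.prob (random_clause k P n) (UNIV - ?B)"
  proof (intro measure_pmf.finite_measure_mono_AE AE_pmfI impI)
    fix c assume c: "c \<in> set_pmf (random_clause k P n)" "c \<in> {c. map \<sigma> (snd c) \<in> fst c}"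
    have "c \<in> set_pmf P \<times> var_tuples k {..<n}"
      using set_random_clause[OF z(3)] c(1) by (rule subsetD)
    then have "length (snd c) = k" by (auto simp: var_tuples_def)
    moreover have "map \<sigma> (snd c) = map (\<lambda>_. b) (snd c)" if "set (snd c) \<subseteq> ?Z b"
      using that by (intro map_cong) auto
    ultimately have "map \<sigma> (snd c) = replicate k b" if "set (snd c) \<subseteq> ?Z b"
      using that by (simp add: map_replicate_const)
    \<comment> \<open>On variables that all have value b the clause reads the word forbidden by
      \<open>D b\<close>, so a satisfied clause lies outside \<open>?B\<close>.\<close>
    then show "c \<in> UNIV - ?B" using c D[of b] by auto
  qed simp
  also have "\<dots> = 1 - measure_pmf.prob (random_clause k P n) ?B"
    using measure_pmf.prob_compl[of ?B "random_clause k P n"] by simp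
  finally show ?thesis using B by simp
qed

text \<open>Each assignment satisfies a random clause with probability at most some s < 1, so K n
  independent clauses outweigh the 2^n assignments once s^K < 1/4.\<close>

lemma prob_sat_exponentially_small:
  assumes k: "0 < k" and D: "\<And>b. \<exists>R\<in>set_pmf P. replicate k b \<notin> R"
  obtains K :: nat where "0 < K" "\<And>n. 2 * k \<le> n \<Longrightarrow> prob_sat k P n (K * n) \<le> (1/2) ^ n"
proof -
  obtain D where D: "\<And>b. D b \<in> set_pmf P \<and> replicate k b \<notin> D b" using D by metis
  \<comment> \<open>The majority value depends on the assignment, so the smaller of the two
    probabilities is taken.\<close>
  define p where "p = min (pmf P (D True)) (pmf P (D False))"
  have "p \<le> pmf P (D b)" for b by (cases b) (simp_all add: p_def)
  moreover have "0 < p" using D by (simp add: p_def pmf_positive)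
  ultimately have p: "\<And>b. p \<le> pmf P (D b)" "0 < p" by auto
  define s where "s = 1 - (1 / (2 * real k)) ^ k * p"
  have "s < 1" using p k by (simp add: s_def)
  then obtain K where K: "s ^ K < 1 / 4" using real_arch_pow_inv[of "1/4" s] by auto
  have s: "measure_pmf.prob (random_clause k P n) {c. map \<sigma> (snd c) \<in> fst c} \<le> s"
    if "2 * k \<le> n" for n \<sigma>
    unfolding s_def using prob_clause_satisfied_le[OF k that D p(1)] p(2) by simp
  \<comment> \<open>\<open>s\<close> bounds a probability already at n = 2k.\<close>
  have "0 \<le> s" using s[of "2 * k"] measure_nonneg order_trans by blast
  have "prob_sat k P n (K * n) \<le> (1/2) ^ n" if n: "2 * k \<le> n" for n
  proof -
    have "prob_sat k P n (K * n) \<le> 2 ^ n * s ^ (K * n)"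
      using n s by (intro prob_sat_le) auto
    also have "\<dots> = (2 * s ^ K) ^ n" by (simp add: power_mult power_mult_distrib)
    also have "\<dots> \<le> (1/2) ^ n" using K \<open>0 \<le> s\<close> by (intro power_mono) auto
    finally show ?thesis .
  qed
  moreover have "0 < K" using K by (cases K) auto
  ultimately show thesis using that by blast
qed

section \<open>Size of the spine and the phase transition\<close>

text \<open>A subformula G attaining \<open>cstar\<close> of a minimally unsatisfiable F in \<Phi>
  has density above \<alpha>. As \<Phi> has no such dense spot on at most b variables, G has more
  than b variables, all of them in the spine.\<close>

lemma large_spine_if_unsatisfiable:
  assumes C: "\<forall>F. is_formula k C UNIV F \<and> minimally_unsatisfiable F \<longrightarrow> \<alpha> < cstar F"
    and \<Phi>: "finite \<Phi>" "\<Phi> \<subseteq> C \<times> var_tuples k {..<n}" "\<not> satisfiable \<Phi>"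
    and k: "0 < k" and sparse: "\<not> locally_dense \<alpha> b n \<Phi>"
  shows "b \<le> real (card (spine k C {..<n} \<Phi>))"
proof -
  obtain F where F: "F \<subseteq> \<Phi>" "minimally_unsatisfiable F"
    by (rule unsatisfiable_contains_minimal[OF \<Phi>(1,3)])
  have "finite F" using F(1) \<Phi>(1) by (rule finite_subset)
  moreover have "var_tuples k {..<n} \<subseteq> var_tuples k UNIV" by (auto simp: var_tuples_def)
  ultimately have "is_formula k C UNIV F"
    unfolding is_formula_def using F(1) \<Phi>(2) by blast
  then have \<alpha>: "\<alpha> < cstar F" using C F(2) by blast
  have "F \<noteq> {}" using F(2) by (auto simp: minimally_unsatisfiable_def satisfiable_def)
  then obtain G where G: "G \<noteq> {}" "G \<subseteq> F" "cstar F = real (card G) / real (card (vars G))"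
    by (rule cstar_attained[OF \<open>finite F\<close>])
  have "vars G \<subseteq> vars F" using G(2) by (auto simp: vars_def)
  also have vF: "vars F \<subseteq> spine k C {..<n} \<Phi>"
    by (rule vars_minimally_unsatisfiable_subset_spine[OF F(2,1) \<Phi>(2)])
  finally have sub: "vars G \<subseteq> spine k C {..<n} \<Phi>" .
  then have Gn: "vars G \<subseteq> {..<n}" using spine_subset by blast
  obtain R xs where c: "(R, xs) \<in> G" using G(1) by auto
  then have "length xs = k" "set xs \<subseteq> vars G"
    using G(2) F(1) \<Phi>(2) by (auto simp: var_tuples_def vars_def)
  \<comment> \<open>Positive arity makes the denominator in \<open>cstar\<close> nonzero; division
    by zero would yield 0 and carry no information.\<close>
  then have "vars G \<noteq> {}" using k by auto
  then have pos: "0 < card (vars G)"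
    using finite_subset[OF Gn] by (simp add: card_gt_0_iff)
  then have "\<alpha> * real (card (vars G)) < real (card G)"
    using \<alpha> G(3) by (simp add: field_simps)
  then have "b < real (card (vars G))"
    using sparse order_trans[OF G(2) F(1)] Gn pos unfolding locally_dense_def by force
  also have "card (vars G) \<le> card (spine k C {..<n} \<Phi>)"
    by (intro card_mono sub finite_subset[OF spine_subset]) simp
  finally show ?thesis by simp
qed

theorem theorem4:
  fixes k :: nat and C :: "bool list set set"
  assumes "2 \<le> k"
    and "\<forall>R\<in>C. is_constraint k R"
    and "sharp_threshold k (pmf_of_set C)"
    and "\<exists>\<epsilon>>0. \<forall>F. is_formula k C UNIV F \<and> minimally_unsatisfiable F \<longrightarrow>
           cstar F > (1 + \<epsilon>) / (real k - 1)"
  shows "\<forall>P :: bool list set pmf. set_pmf P = C \<longrightarrow> first_order_phase_transition k P"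
proof (intro allI impI)
  fix P :: "bool list set pmf"
  assume P: "set_pmf P = C"
  have k: "2 \<le> k" "0 < k" using assms(1) by auto
  obtain \<epsilon>' where e': "0 < \<epsilon>'" and C': "\<forall>F. is_formula k C UNIV F \<and> minimally_unsatisfiable F \<longrightarrow>
           (1 + \<epsilon>') / (real k - 1) < cstar F"
    using assms(4) by auto
  \<comment> \<open>The counting bound asks for \<epsilon> \<le> 1; shrinking \<epsilon> only lowers
    the required density.\<close>
  define \<epsilon> where "\<epsilon> = min \<epsilon>' 1"
  have e: "0 < \<epsilon>" "\<epsilon> \<le> 1" using e' by (simp_all add: \<epsilon>_def)
  define \<alpha> where "\<alpha> = (1 + \<epsilon>) / (real k - 1)"
  have "\<alpha> \<le> (1 + \<epsilon>') / (real k - 1)"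
    unfolding \<alpha>_def using k by (intro divide_right_mono) (auto simp: \<epsilon>_def)
  then have C: "\<forall>F. is_formula k C UNIV F \<and> minimally_unsatisfiable F \<longrightarrow> \<alpha> < cstar F"
    using C' by (meson le_less_trans)
  show "first_order_phase_transition k P"
  proof (cases "\<exists>b. \<forall>R\<in>set_pmf P. replicate k b \<in> R")
    case True
    then obtain b where b: "\<forall>R\<in>set_pmf P. replicate k b \<in> R" by blast
    \<comment> \<open>From n = k on every random formula is satisfiable, so the premise of the
      transition never holds and any \<eta> serves.\<close>
    have "\<not> (\<lambda>n. prob_sat k P n (M n)) \<longlonglongrightarrow> 0" for M
    proof
      assume lim: "(\<lambda>n. prob_sat k P n (M n)) \<longlonglongrightarrow> 0"
      have "\<forall>\<^sub>F n in sequentially. prob_sat k P n (M n) = 1"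
        using eventually_ge_at_top[of k] by eventually_elim (rule prob_sat_eq_1[OF _ b])
      then have "(\<lambda>n. prob_sat k P n (M n)) \<longlonglongrightarrow> 1" by (rule tendsto_eventually)
      then show False using lim LIMSEQ_unique by fastforce
    qed
    then show ?thesis
      unfolding first_order_phase_transition_def by (intro exI[of _ 1]) auto
  next
    case False
    then have "\<exists>R\<in>set_pmf P. replicate k b \<notin> R" for b by blast
    then obtain K :: nat where K: "0 < K"
      "\<And>n. 2 * k \<le> n \<Longrightarrow> prob_sat k P n (K * n) \<le> (1/2) ^ n"
      using prob_sat_exponentially_small[OF k(2), of P] by metis
    obtain \<delta> A :: real where \<delta>: "0 < \<delta>" and A: "\<And>P n M. \<lbrakk>k \<le> n; real M \<le> real K * real n\<rbrakk> \<Longrightarrow>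
       measure_pmf.prob (random_formula k P n M) {\<Phi>. locally_dense \<alpha> (\<delta> * real n) n \<Phi>}
         \<le> A * real n powr (- \<epsilon>)"
      unfolding \<alpha>_def by (rule prob_locally_dense_le[OF k(1) e, of "real K"]) (use K in auto)
    define S where "S n = {\<Phi>. \<delta> \<le> real (card (spine k C {..<n} \<Phi>)) / real n}" for n
    have bound: "1 - (prob_sat k P n M + (1/2) ^ n + A * real n powr (- \<epsilon>))
        \<le> measure_pmf.prob (random_formula k P n M) (S n)" if n: "2 * k \<le> n" for n M
    proof -
      \<comment> \<open>The dense-spot bound covers at most K n constraints. The estimate for
        \<open>M'\<close> passes to \<open>M\<close> because \<open>S n\<close> is closed under
        adding constraints.\<close>
      define M' where "M' = min M (K * n)"
      let ?\<mu> = "measure_pmf.prob (random_formula k P n M')"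
      let ?L = "{\<Phi>. locally_dense \<alpha> (\<delta> * real n) n \<Phi>}"
      have kn: "k \<le> n" "0 < n" using n k by auto
      have "1 = ?\<mu> UNIV" by simp
      \<comment> \<open>Every formula in the support is satisfiable, locally dense or has a large
        spine.\<close>
      also have "\<dots> \<le> ?\<mu> ({\<Phi>. satisfiable \<Phi>} \<union> ?L \<union> S n)"
      proof (intro measure_pmf.finite_measure_mono_AE AE_pmfI impI)
        fix \<Phi> assume "\<Phi> \<in> set_pmf (random_formula k P n M')"
        then have \<Phi>: "finite \<Phi>" "\<Phi> \<subseteq> C \<times> var_tuples k {..<n}"
          using set_random_formula[OF kn(1)] P by blast+
        show "\<Phi> \<in> {\<Phi>. satisfiable \<Phi>} \<union> ?L \<union> S n"
          using large_spine_if_unsatisfiable[OF C \<Phi> _ k(2)] kn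
          by (auto simp: S_def field_simps)
      qed simp
      also have "\<dots> \<le> ?\<mu> ({\<Phi>. satisfiable \<Phi>} \<union> ?L) + ?\<mu> (S n)"
        by (intro measure_Un_le) auto
      also have "\<dots> \<le> ?\<mu> {\<Phi>. satisfiable \<Phi>} + ?\<mu> ?L + ?\<mu> (S n)"
        by (intro add_right_mono measure_Un_le) auto
      also have "\<dots> \<le> (prob_sat k P n M + (1/2) ^ n) + A * real n powr (- \<epsilon>)
          + measure_pmf.prob (random_formula k P n M) (S n)"
      proof (intro add_mono)
        have "?\<mu> {\<Phi>. satisfiable \<Phi>} = prob_sat k P n M'" by (simp add: prob_sat_def)
        moreover have "0 \<le> prob_sat k P n M" by (simp add: prob_sat_def)
        \<comment> \<open>Either \<open>M' = M\<close>, or \<open>M' = K * n\<close> and the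
          exponential bound applies; the sum covers both cases.\<close>
        ultimately show "?\<mu> {\<Phi>. satisfiable \<Phi>} \<le> prob_sat k P n M + (1/2) ^ n"
          using K(2)[OF n] by (cases "M \<le> K * n") (auto simp: M'_def min_def)
        have "real M' \<le> real (K * n)" unfolding M'_def of_nat_le_iff by simp
        then show "?\<mu> ?L \<le> A * real n powr (- \<epsilon>)" using kn by (intro A) simp_all
        show "?\<mu> (S n) \<le> measure_pmf.prob (random_formula k P n M) (S n)"
        proof (rule prob_random_formula_mono)
          fix F c assume F: "F \<in> S n"
          have "card (spine k C {..<n} F) \<le> card (spine k C {..<n} (insert c F))"
            by (intro card_mono spine_mono finite_subset[OF spine_subset]) auto
          then have "real (card (spine k C {..<n} F)) / real n
              \<le> real (card (spine k C {..<n} (insert c F))) / real n"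
            by (intro divide_right_mono) auto
          then show "insert c F \<in> S n" using F by (simp add: S_def)
        qed (simp add: M'_def)
      qed
      finally show ?thesis by simp
    qed
    have "(\<lambda>n. measure_pmf.prob (random_formula k P n (M n)) (S n)) \<longlonglongrightarrow> 1"
      if M: "(\<lambda>n. prob_sat k P n (M n)) \<longlonglongrightarrow> 0" for M
    proof (rule tendsto_sandwich[where h = "\<lambda>_. 1"])
      have "(\<lambda>n. A * real n powr (- \<epsilon>)) \<longlonglongrightarrow> A * 0"
        using e by (intro tendsto_mult tendsto_const tendsto_neg_powr filterlim_real_sequentially) auto
      moreover have "(\<lambda>n. (1/2 :: real) ^ n) \<longlonglongrightarrow> 0" by (rule LIMSEQ_power_zero) simp
      ultimately have "(\<lambda>n. 1 - (prob_sat k P n (M n) + (1/2) ^ n + A * real n powr (- \<epsilon>)))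
          \<longlonglongrightarrow> 1 - (0 + 0 + A * 0)"
        using M by (intro tendsto_diff tendsto_add tendsto_const)
      then show "(\<lambda>n. 1 - (prob_sat k P n (M n) + (1/2) ^ n + A * real n powr (- \<epsilon>))) \<longlonglongrightarrow> 1"
        by simp
      show "\<forall>\<^sub>F n in sequentially. 1 - (prob_sat k P n (M n) + (1/2) ^ n + A * real n powr (- \<epsilon>))
          \<le> measure_pmf.prob (random_formula k P n (M n)) (S n)"
        using eventually_ge_at_top[of "2 * k"] by eventually_elim (rule bound)
    qed simp_all
    then show ?thesis
      unfolding first_order_phase_transition_def P using \<delta> by (auto simp: S_def)
  qed
qed

end
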